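(* Let $\mu=p/q$ be a positive rational number, where $p,q$ are co-prime positive integers. Then the real vector space $(\Sigma_\mu,\boxplus)$ is of countably infinite dimension, and it is generated (linearly spanned) by the set $$\bigcup_{k\ge 1}\ \bigcup_{\substack{1\le i\le kp\\ 1\le j\le kq}}\left\{\left\langle E^{kp\times kq}_{ij}\right\rangle\right\}.$$
   Context: All matrices are real. $\mathcal{M}_{m\times n}$ is the set of $m\times n$ real matrices ($m,n$ positive integers), $\otimes$ is the Kronecker product, $I_s$ is the $s\times s$ identity matrix, and $\operatorname{lcm}$ is the least common multiple. For a positive rational number $\mu$, $\mathcal{M}_\mu$ is the set of all real matrices of size $m\times n$ with $m,n$ positive integers and $m/n=\mu$. Identity equivalence: two matrices $A,B$ satisfy $A\sim B$ if there exist positive integers $s,t$ with $A\otimes I_s=B\otimes I_t$. This is an equivalence relation; $\langle A\rangle$ denotes the class of $A$, and $\Sigma_\mu:=\mathcal{M}_\mu/\!\sim$. Semi-tensor addition (denoted $\boxplus$ here): for $A\in\mathcal{M}_{m\times n}$, $B\in\mathcal{M}_{r\times s}$ with $m/n=r/s=\mu$ and $t=\operatorname{lcm}(m,r)$, $A\boxplus B:=(A\otimes I_{t/m})+(B\otimes I_{t/r})$. The relation $\sim$ is a congruence for $\boxplus$, so $\langle A\rangle\boxplus\langle B\rangle:=\langle A\boxplus B\rangle$ is well defined on $\Sigma_\mu$. With this addition and the scalar multiplication $c\langle A\rangle:=\langle cA\rangle$ ($c\in\mathbb{R}$), $\Sigma_\mu$ is a real vector space. $E^{m\times n}_{ij}$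 denotes the $m\times n$ matrix whose $(i,j)$ entry is $1$ and whose other entries are all $0$. *)

theory Defs
  imports "Jordan_Normal_Form.VS_Connect" "HOL-Library.Countable_Set"
begin

definition kronecker :: "real mat \<Rightarrow> real mat \<Rightarrow> real mat"  (infixl \<open>\<otimes>\<^sub>m\<close> 70)
  where "A \<otimes>\<^sub>m B = mat (dim_row A * dim_row B) (dim_col A * dim_col B)
    (\<lambda>(i, j). A $$ (i div dim_row B, j div dim_col B) * B $$ (i mod dim_row B, j mod dim_col B))"

definition mats_of_ratio :: "rat \<Rightarrow> real mat set"
  where "mats_of_ratio \<mu> =
    {A. 0 < dim_row A \<and> 0 < dim_col A \<and> of_nat (dim_row A) / of_nat (dim_col A) = \<mu>}"

definition id_equiv :: "(real mat \<times> real mat) set"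
  where "id_equiv = {(A, B). \<exists>s>0. \<exists>t>0. A \<otimes>\<^sub>m 1\<^sub>m s = B \<otimes>\<^sub>m 1\<^sub>m t}"

definition id_class :: "real mat \<Rightarrow> real mat set"  (\<open>\<langle>_\<rangle>\<close>)
  where "\<langle>A\<rangle> = id_equiv `` {A}"

definition st_add :: "real mat \<Rightarrow> real mat \<Rightarrow> real mat"  (infixl \<open>\<boxplus>\<close> 65)
  where "A \<boxplus> B = (let t = lcm (dim_row A) (dim_row B)
    in (A \<otimes>\<^sub>m 1\<^sub>m (t div dim_row A)) + (B \<otimes>\<^sub>m 1\<^sub>m (t div dim_row B)))"

definition class_add :: "real mat set \<Rightarrow> real mat set \<Rightarrow> real mat set"
  where "class_add X Y = (\<Union>A\<in>X. \<Union>B\<in>Y. \<langle>A \<boxplus> B\<rangle>)"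

definition class_smult :: "real \<Rightarrow> real mat set \<Rightarrow> real mat set"
  where "class_smult c X = (\<Union>A\<in>X. \<langle>c \<cdot>\<^sub>m A\<rangle>)"

definition class_zero :: "rat \<Rightarrow> real mat set"
  where "class_zero \<mu> = (case quotient_of \<mu> of (p, q) \<Rightarrow> \<langle>0\<^sub>m (nat p) (nat q)\<rangle>)"

(* The record type extends that of rings; the fields mult and one play no role in a module. *)
definition Sigma_space :: "rat \<Rightarrow> (real, real mat set) module"
  where "Sigma_space \<mu> =
    \<lparr>carrier = mats_of_ratio \<mu> // id_equiv, mult = undefined, one = undefined,
     zero = class_zero \<mu>, add = class_add, smult = class_smult\<rparr>"

(* Indices are 1-based here, while matrix entries in the library are 0-based. *)
definition unit_mat :: "nat \<Rightarrow> nat \<Rightarrow> nat \<Rightarrow> nat \<Rightarrow> real mat"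
  where "unit_mat m n i j = mat m n (\<lambda>(a, b). if Suc a = i \<and> Suc b = j then 1 else 0)"

lemma kron_one_dims [simp]:
  "dim_row (A \<otimes>\<^sub>m 1\<^sub>m s) = dim_row A * s" "dim_col (A \<otimes>\<^sub>m 1\<^sub>m s) = dim_col A * s"
  by (simp_all add: kronecker_def)

lemma kron_one_index:
  assumes "i < dim_row A * s" "j < dim_col A * s"
  shows "(A \<otimes>\<^sub>m 1\<^sub>m s) $$ (i, j) = (if i mod s = j mod s then A $$ (i div s, j div s) else 0)"
proof -
  have "s > 0" using assms by (cases s) auto
  then show ?thesis using assms by (simp add: kronecker_def)
qed

lemma kron_one_assoc: "(A \<otimes>\<^sub>m 1\<^sub>m s) \<otimes>\<^sub>m 1\<^sub>m t = A \<otimes>\<^sub>m 1\<^sub>m (s * t)"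
proof (rule eq_matI)
  fix i j assume "i < dim_row (A \<otimes>\<^sub>m 1\<^sub>m (s * t))" "j < dim_col (A \<otimes>\<^sub>m 1\<^sub>m (s * t))"
  then have i: "i < dim_row A * s * t" and j: "j < dim_col A * s * t" by (simp_all add: mult.assoc)
  then have i': "i div t < dim_row A * s" and j': "j div t < dim_col A * s"
    by (simp_all add: less_mult_imp_div_less)
  have m: "k mod (s * t) = t * (k div t mod s) + k mod t" for k :: nat
    by (metis mod_mult2_eq mult.commute)
  have t: "t > 0" using i by (cases t) auto
  have eq: "i mod (s * t) = j mod (s * t) \<longleftrightarrow> i mod t = j mod t \<and> i div t mod s = j div t mod s"
    (is "?l \<longleftrightarrow> ?r")
  proof
    assume l: ?l
    have a: "i mod t = j mod t" using l by (metis mod_mod_cancel dvd_triv_right)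
    show ?r using l a t unfolding m by simp
  qed (simp add: m)
  show "((A \<otimes>\<^sub>m 1\<^sub>m s) \<otimes>\<^sub>m 1\<^sub>m t) $$ (i, j) = (A \<otimes>\<^sub>m 1\<^sub>m (s * t)) $$ (i, j)"
    using i j i' j' eq
    by (simp add: kron_one_index mult.assoc div_mult2_eq[symmetric] mult.commute[of t s])
qed (simp_all add: mult.assoc)

lemma kron_one_1 [simp]: "A \<otimes>\<^sub>m 1\<^sub>m (Suc 0) = A"
  by (rule eq_matI) (auto simp: kron_one_index)

lemma kron_one_add:
  assumes "A \<in> carrier_mat m n" "B \<in> carrier_mat m n"
  shows "(A + B) \<otimes>\<^sub>m 1\<^sub>m s = A \<otimes>\<^sub>m 1\<^sub>m s + B \<otimes>\<^sub>m 1\<^sub>m s"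
  using assms
  by (intro eq_matI) (auto simp: kron_one_index less_mult_imp_div_less)

lemma kron_one_smult: "(c \<cdot>\<^sub>m A) \<otimes>\<^sub>m 1\<^sub>m s = c \<cdot>\<^sub>m (A \<otimes>\<^sub>m 1\<^sub>m s)"
  by (intro eq_matI) (auto simp: kron_one_index less_mult_imp_div_less)

lemma kron_one_zero: "0\<^sub>m m n \<otimes>\<^sub>m 1\<^sub>m s = 0\<^sub>m (m * s) (n * s)"
  by (intro eq_matI) (auto simp: kron_one_index less_mult_imp_div_less)

lemma id_equivI: "A \<otimes>\<^sub>m 1\<^sub>m s = B \<otimes>\<^sub>m 1\<^sub>m t \<Longrightarrow> s > 0 \<Longrightarrow> t > 0 \<Longrightarrow> (A, B) \<in> id_equiv"
  by (auto simp: id_equiv_def)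

lemma equiv_id_equiv: "equiv UNIV id_equiv"
proof (rule equivI)
  show "refl id_equiv" by (rule refl_onI) (auto intro: id_equivI[of _ 1 _ 1])
  show "sym id_equiv" by (rule symI) (auto simp: id_equiv_def, metis)
  show "trans id_equiv"
  proof (rule transI)
    fix A B C assume "(A, B) \<in> id_equiv" "(B, C) \<in> id_equiv"
    then obtain s t u v where *: "s > 0" "t > 0" "u > 0" "v > 0"
        "A \<otimes>\<^sub>m 1\<^sub>m s = B \<otimes>\<^sub>m 1\<^sub>m t" "B \<otimes>\<^sub>m 1\<^sub>m u = C \<otimes>\<^sub>m 1\<^sub>m v"
      by (auto simp: id_equiv_def)
    have "A \<otimes>\<^sub>m 1\<^sub>m (s * u) = (B \<otimes>\<^sub>m 1\<^sub>m u) \<otimes>\<^sub>m 1\<^sub>m t"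
      by (simp only: kron_one_assoc[symmetric] *(5)) (simp only: kron_one_assoc mult.commute)
    then have "A \<otimes>\<^sub>m 1\<^sub>m (s * u) = C \<otimes>\<^sub>m 1\<^sub>m (v * t)"
      using *(6) by (simp add: kron_one_assoc)
    then show "(A, C) \<in> id_equiv" by (rule id_equivI) (simp_all add: *(1-4))
  qed
qed simp

lemma id_class_eq_iff: "\<langle>A\<rangle> = \<langle>B\<rangle> \<longleftrightarrow> (A, B) \<in> id_equiv"
  unfolding id_class_def using eq_equiv_class_iff[OF equiv_id_equiv] by simp

lemma id_class_self: "A \<in> \<langle>A\<rangle>"
  unfolding id_class_def using equiv_class_self[OF equiv_id_equiv] by simp

lemma id_class_memD: "B \<in> \<langle>A\<rangle> \<Longrightarrow> \<langle>B\<rangle> = \<langle>A\<rangle>"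
  unfolding id_class_eq_iff using equiv_id_equiv
  by (auto simp: id_class_def equiv_def dest: symD)

lemma id_class_kron_one: "s > 0 \<Longrightarrow> \<langle>A \<otimes>\<^sub>m 1\<^sub>m s\<rangle> = \<langle>A\<rangle>"
  unfolding id_class_eq_iff by (rule id_equivI[of _ 1 _ s]) auto

lemma ratio_cols:
  assumes "A \<in> mats_of_ratio \<mu>" "B \<in> mats_of_ratio \<mu>"
  shows "dim_row A * dim_col B = dim_row B * dim_col A"
proof -
  have "of_nat (dim_row A) * of_nat (dim_col B) = (of_nat (dim_row B) * of_nat (dim_col A) :: rat)"
    using assms by (auto simp: mats_of_ratio_def frac_eq_eq)
  then show ?thesis by (metis of_nat_eq_iff of_nat_mult)
qed

lemma ratio_cols_eq:
  assumes "A \<in> mats_of_ratio \<mu>" "B \<in> mats_of_ratio \<mu>" "dim_row A = dim_row B"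
  shows "dim_col A = dim_col B"
  using ratio_cols[OF assms(1,2)] assms by (auto simp: mats_of_ratio_def)

lemma ratio_kron_one: "A \<in> mats_of_ratio \<mu> \<Longrightarrow> s > 0 \<Longrightarrow> A \<otimes>\<^sub>m 1\<^sub>m s \<in> mats_of_ratio \<mu>"
  by (auto simp: mats_of_ratio_def)

lemma ratio_kron_one_iff: "s > 0 \<Longrightarrow> A \<otimes>\<^sub>m 1\<^sub>m s \<in> mats_of_ratio \<mu> \<longleftrightarrow> A \<in> mats_of_ratio \<mu>"
  by (auto simp: mats_of_ratio_def)

lemma ratio_id_class: "A \<in> mats_of_ratio \<mu> \<Longrightarrow> B \<in> \<langle>A\<rangle> \<Longrightarrow> B \<in> mats_of_ratio \<mu>"
  by (auto simp: id_class_def id_equiv_def) (metis ratio_kron_one_iff)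

lemma ratio_carrier:
  "A \<in> mats_of_ratio \<mu> \<Longrightarrow> A \<in> carrier_mat m n \<Longrightarrow> B \<in> carrier_mat m n \<Longrightarrow> B \<in> mats_of_ratio \<mu>"
  by (auto simp: mats_of_ratio_def)

lemma st_add_common:
  assumes A: "A \<in> mats_of_ratio \<mu>" and B: "B \<in> mats_of_ratio \<mu>"
    and s: "s > 0" "u > 0" and eq: "dim_row A * s = dim_row B * u"
  shows "\<langle>A \<boxplus> B\<rangle> = \<langle>A \<otimes>\<^sub>m 1\<^sub>m s + B \<otimes>\<^sub>m 1\<^sub>m u\<rangle>"
proof -
  let ?m = "dim_row A" and ?r = "dim_row B"
  define t where "t = lcm ?m ?r"
  have pos: "?m > 0" "?r > 0" using A B by (auto simp: mats_of_ratio_def)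
  have "t dvd ?m * s" unfolding t_def using eq by (metis dvd_triv_left lcm_least)
  then obtain k where k: "?m * s = t * k" by blast
  have k0: "k > 0" using k pos s by (cases k) auto
  define a b where "a = t div ?m" and "b = t div ?r"
  have t: "t = ?m * a" "t = ?r * b" by (simp_all add: a_def b_def t_def)
  have t0: "t > 0" using pos by (simp add: t_def lcm_pos_nat)
  have ab0: "a > 0" "b > 0" using t t0 by (auto intro: Nat.gr0I)
  have "?m * s = ?m * (a * k)" using k t(1) by (simp add: mult.assoc)
  then have sk: "s = a * k" using pos by simp
  have "?r * u = ?r * (b * k)" using k eq t(2) by (simp add: mult.assoc)
  then have uk: "u = b * k" using pos by simp
  have ca: "A \<otimes>\<^sub>m 1\<^sub>m a \<in> carrier_mat t (dim_col A * a)" using t by auto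
  have "dim_col (A \<otimes>\<^sub>m 1\<^sub>m a) = dim_col (B \<otimes>\<^sub>m 1\<^sub>m b)"
    by (rule ratio_cols_eq[OF ratio_kron_one[OF A ab0(1)] ratio_kron_one[OF B ab0(2)]]) (use t in simp)
  then have cb: "B \<otimes>\<^sub>m 1\<^sub>m b \<in> carrier_mat t (dim_col A * a)" using t by auto
  have "A \<boxplus> B = A \<otimes>\<^sub>m 1\<^sub>m a + B \<otimes>\<^sub>m 1\<^sub>m b"
    by (simp add: st_add_def Let_def t_def[symmetric] a_def b_def)
  then have "(A \<boxplus> B) \<otimes>\<^sub>m 1\<^sub>m k = A \<otimes>\<^sub>m 1\<^sub>m s + B \<otimes>\<^sub>m 1\<^sub>m u"
    by (simp add: kron_one_add[OF ca cb] kron_one_assoc sk uk)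
  then show ?thesis using id_class_kron_one[OF k0, of "A \<boxplus> B"] by simp
qed

lemma st_add_cong:
  assumes A: "A \<in> mats_of_ratio \<mu>" and B: "B \<in> mats_of_ratio \<mu>"
    and A': "A' \<in> \<langle>A\<rangle>" and B': "B' \<in> \<langle>B\<rangle>"
  shows "\<langle>A' \<boxplus> B'\<rangle> = \<langle>A \<boxplus> B\<rangle>"
proof -
  note R = ratio_id_class[OF A A'] ratio_id_class[OF B B']
  obtain s s' where s: "s > 0" "s' > 0" "A \<otimes>\<^sub>m 1\<^sub>m s = A' \<otimes>\<^sub>m 1\<^sub>m s'"
    using A' by (auto simp: id_class_def id_equiv_def)
  obtain u u' where u: "u > 0" "u' > 0" "B \<otimes>\<^sub>m 1\<^sub>m u = B' \<otimes>\<^sub>m 1\<^sub>m u'"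
    using B' by (auto simp: id_class_def id_equiv_def)
  define x y where "x = dim_row B * u" and "y = dim_row A * s"
  have x': "x = dim_row B' * u'" unfolding x_def using u(3) by (metis kron_one_dims(1))
  have y': "y = dim_row A' * s'" unfolding y_def using s(3) by (metis kron_one_dims(1))
  have xy: "x > 0" "y > 0" using A B s u by (auto simp: x_def y_def mats_of_ratio_def)
  have "\<langle>A \<boxplus> B\<rangle> = \<langle>A \<otimes>\<^sub>m 1\<^sub>m (s * x) + B \<otimes>\<^sub>m 1\<^sub>m (u * y)\<rangle>"
    by (rule st_add_common[OF A B]) (use s u xy in \<open>auto simp: x_def y_def\<close>)
  also have "\<dots> = \<langle>A' \<otimes>\<^sub>m 1\<^sub>m (s' * x) + B' \<otimes>\<^sub>m 1\<^sub>m (u' * y)\<rangle>"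
    using s(3) u(3) by (simp add: kron_one_assoc[symmetric])
  also have "\<dots> = \<langle>A' \<boxplus> B'\<rangle>"
    by (rule st_add_common[OF R, symmetric]) (use s u xy in \<open>auto simp: x' y'\<close>)
  finally show ?thesis by simp
qed

lemma class_add_id_class:
  assumes "A \<in> mats_of_ratio \<mu>" "B \<in> mats_of_ratio \<mu>"
  shows "class_add \<langle>A\<rangle> \<langle>B\<rangle> = \<langle>A \<boxplus> B\<rangle>"
  unfolding class_add_def using st_add_cong[OF assms] id_class_self by blast

lemma class_smult_id_class: "class_smult c \<langle>A\<rangle> = \<langle>c \<cdot>\<^sub>m A\<rangle>"
proof -
  have "\<langle>c \<cdot>\<^sub>m A'\<rangle> = \<langle>c \<cdot>\<^sub>m A\<rangle>" if "A' \<in> \<langle>A\<rangle>" for A'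
  proof -
    obtain s t where st: "s > 0" "t > 0" "A \<otimes>\<^sub>m 1\<^sub>m s = A' \<otimes>\<^sub>m 1\<^sub>m t"
      using \<open>A' \<in> \<langle>A\<rangle>\<close> by (auto simp: id_class_def id_equiv_def)
    show ?thesis unfolding id_class_eq_iff
      by (rule id_equivI[of _ t _ s]) (use st in \<open>simp_all add: kron_one_smult\<close>)
  qed
  then show ?thesis unfolding class_smult_def using id_class_self by blast
qed

lemma class_add_same_size:
  assumes A: "A \<in> mats_of_ratio \<mu>" and c: "A \<in> carrier_mat m n" "B \<in> carrier_mat m n"
  shows "class_add \<langle>A\<rangle> \<langle>B\<rangle> = \<langle>A + B\<rangle>"
proof -
  note B = ratio_carrier[OF A c]
  show ?thesis
    using class_add_id_class[OF A B] st_add_common[OF A B, of 1 1] c by simp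
qed

lemma class_zero_eq:
  assumes "0\<^sub>m m n \<in> mats_of_ratio \<mu>"
  shows "class_zero \<mu> = \<langle>0\<^sub>m m n\<rangle>"
proof -
  obtain p q where pq: "quotient_of \<mu> = (p, q)" by force
  have mn: "m > 0" "n > 0" "\<mu> = of_nat m / of_nat n" using assms by (auto simp: mats_of_ratio_def)
  have q: "q > 0" using pq by (rule quotient_of_denom_pos)
  have mu: "\<mu> = of_int p / of_int q" using pq by (rule quotient_of_div)
  have "0 < \<mu>" using mn by simp
  then have p: "p > 0" using mu q by (simp add: zero_less_divide_iff)
  have "of_nat (m * nat q) = (of_nat (nat p * n) :: rat)"
    using mn mu p q by (simp add: frac_eq_eq)
  then have e: "m * nat q = nat p * n" using of_nat_eq_iff by blast
  have "\<langle>0\<^sub>m (nat p) (nat q)\<rangle> = \<langle>0\<^sub>m m n\<rangle>" unfolding id_class_eq_iff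
    by (rule id_equivI[of _ m _ "nat p"])
      (use mn p e in \<open>simp_all add: kron_one_zero mult.commute\<close>)
  then show ?thesis by (simp add: class_zero_def pq)
qed

lemma Sigma_carrier: "carrier (Sigma_space \<mu>) = id_class ` mats_of_ratio \<mu>"
  by (auto simp: Sigma_space_def quotient_def id_class_def)

lemma Sigma_common:
  assumes "X \<in> carrier (Sigma_space \<mu>)" "Y \<in> carrier (Sigma_space \<mu>)" "Z \<in> carrier (Sigma_space \<mu>)"
  obtains m n A B C where "A \<in> mats_of_ratio \<mu>"
    "A \<in> carrier_mat m n" "B \<in> carrier_mat m n" "C \<in> carrier_mat m n"
    "X = \<langle>A\<rangle>" "Y = \<langle>B\<rangle>" "Z = \<langle>C\<rangle>"
proof -
  obtain A B C where R: "A \<in> mats_of_ratio \<mu>" "B \<in> mats_of_ratio \<mu>" "C \<in> mats_of_ratio \<mu>"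
    and XYZ: "X = \<langle>A\<rangle>" "Y = \<langle>B\<rangle>" "Z = \<langle>C\<rangle>"
    using assms by (auto simp: Sigma_carrier)
  let ?a = "dim_row A" and ?b = "dim_row B" and ?c = "dim_row C"
  have pos: "?b * ?c > 0" "?a * ?c > 0" "?a * ?b > 0" using R by (auto simp: mats_of_ratio_def)
  let ?A = "A \<otimes>\<^sub>m 1\<^sub>m (?b * ?c)" and ?B = "B \<otimes>\<^sub>m 1\<^sub>m (?a * ?c)" and ?C = "C \<otimes>\<^sub>m 1\<^sub>m (?a * ?b)"
  note R' = ratio_kron_one[OF R(1) pos(1)] ratio_kron_one[OF R(2) pos(2)] ratio_kron_one[OF R(3) pos(3)]
  have rows: "dim_row ?B = dim_row ?A" "dim_row ?C = dim_row ?A" by simp_all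
  have cols: "dim_col ?B = dim_col ?A" "dim_col ?C = dim_col ?A"
    using ratio_cols_eq[OF R'(2) R'(1) rows(1)] ratio_cols_eq[OF R'(3) R'(1) rows(2)] by simp_all
  show thesis
    by (rule that[of ?A "dim_row ?A" "dim_col ?A" ?B ?C, OF R'(1)])
      (use rows cols XYZ id_class_kron_one pos in \<open>auto intro!: carrier_matI simp del: kron_one_dims\<close>)
qed

lemma Sigma_common2:
  assumes "X \<in> carrier (Sigma_space \<mu>)" "Y \<in> carrier (Sigma_space \<mu>)"
  obtains m n A B where "A \<in> mats_of_ratio \<mu>" "A \<in> carrier_mat m n" "B \<in> carrier_mat m n"
    "X = \<langle>A\<rangle>" "Y = \<langle>B\<rangle>"
proof -
  obtain m n A B C where *: "A \<in> mats_of_ratio \<mu>"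
    "A \<in> carrier_mat m n" "B \<in> carrier_mat m n" "C \<in> carrier_mat m n"
    "X = \<langle>A\<rangle>" "Y = \<langle>B\<rangle>" "Y = \<langle>C\<rangle>"
    by (rule Sigma_common[OF assms assms(2)])
  show thesis by (rule that[OF *(1,2,3,5,6)])
qed

lemma Sigma_common1:
  assumes "X \<in> carrier (Sigma_space \<mu>)"
  obtains m n A where "A \<in> mats_of_ratio \<mu>" "A \<in> carrier_mat m n" "X = \<langle>A\<rangle>"
proof -
  obtain m n A B where *: "A \<in> mats_of_ratio \<mu>" "A \<in> carrier_mat m n" "B \<in> carrier_mat m n"
    "X = \<langle>A\<rangle>" "X = \<langle>B\<rangle>"
    by (rule Sigma_common2[OF assms assms])
  show thesis by (rule that[OF *(1,2,4)])
qed

theorem Sigma_vectorspace: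
  assumes "\<mu> > 0"
  shows "vectorspace (class_ring :: real ring) (Sigma_space \<mu>)"
proof -
  let ?V = "Sigma_space \<mu>"
  have sel: "add ?V = class_add" "zero ?V = class_zero \<mu>" "smult ?V = class_smult"
    by (simp_all add: Sigma_space_def)
  have inC: "\<langle>A\<rangle> \<in> carrier ?V" if "A \<in> mats_of_ratio \<mu>" for A
    using that by (simp add: Sigma_carrier)
  have zero: "class_zero \<mu> = \<langle>0\<^sub>m m n\<rangle>" if "A \<in> mats_of_ratio \<mu>" "A \<in> carrier_mat m n" for A m n
    using that by (intro class_zero_eq ratio_carrier[OF that]) simp
  obtain A0 where A0: "A0 \<in> mats_of_ratio \<mu>"
  proof -
    obtain p q where pq: "quotient_of \<mu> = (p, q)" by force
    have q: "q > 0" using pq by (rule quotient_of_denom_pos)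
    have mu: "\<mu> = of_int p / of_int q" using pq by (rule quotient_of_div)
    then have "p > 0" using assms q by (simp add: zero_less_divide_iff)
    then have "0\<^sub>m (nat p) (nat q) \<in> mats_of_ratio \<mu>" using q mu by (simp add: mats_of_ratio_def)
    then show thesis by (rule that)
  qed
  have ag: "abelian_group ?V"
  proof (rule abelian_groupI)
    fix X Y assume "X \<in> carrier ?V" "Y \<in> carrier ?V"
    then obtain m n A B where *: "A \<in> mats_of_ratio \<mu>" "A \<in> carrier_mat m n" "B \<in> carrier_mat m n"
      "X = \<langle>A\<rangle>" "Y = \<langle>B\<rangle>" by (rule Sigma_common2)
    have B: "B \<in> mats_of_ratio \<mu>" using * ratio_carrier by blast
    have S: "A + B \<in> mats_of_ratio \<mu>" using * ratio_carrier[of A \<mu> m n "A + B"] by simp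
    show "X \<oplus>\<^bsub>?V\<^esub> Y \<in> carrier ?V"
      using inC[OF S] class_add_same_size[OF *(1,2,3)] by (simp add: sel *(4,5))
    show "X \<oplus>\<^bsub>?V\<^esub> Y = Y \<oplus>\<^bsub>?V\<^esub> X"
      using class_add_same_size[OF *(1,2,3)] class_add_same_size[OF B *(3,2)]
      by (simp add: sel *(4,5) comm_add_mat[OF *(2,3)])
  next
    fix X Y Z assume "X \<in> carrier ?V" "Y \<in> carrier ?V" "Z \<in> carrier ?V"
    then obtain m n A B C where *: "A \<in> mats_of_ratio \<mu>" "A \<in> carrier_mat m n" "B \<in> carrier_mat m n"
      "C \<in> carrier_mat m n" "X = \<langle>A\<rangle>" "Y = \<langle>B\<rangle>" "Z = \<langle>C\<rangle>" by (rule Sigma_common)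
    have B: "B \<in> mats_of_ratio \<mu>" using * ratio_carrier by blast
    have S: "A + B \<in> mats_of_ratio \<mu>" using * ratio_carrier[of A \<mu> m n "A + B"] by simp
    show "X \<oplus>\<^bsub>?V\<^esub> Y \<oplus>\<^bsub>?V\<^esub> Z = X \<oplus>\<^bsub>?V\<^esub> (Y \<oplus>\<^bsub>?V\<^esub> Z)"
      using class_add_same_size[OF *(1,2,3)] class_add_same_size[OF B *(3,4)]
        class_add_same_size[OF S add_carrier_mat[OF *(3)] *(4)]
        class_add_same_size[OF *(1,2) add_carrier_mat[OF *(4)], of B]
      by (simp add: sel *(5,6,7) assoc_add_mat[OF *(2,3,4)])
  next
    show "\<zero>\<^bsub>?V\<^esub> \<in> carrier ?V"
    proof -
      have c: "A0 \<in> carrier_mat (dim_row A0) (dim_col A0)" by simp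
      show ?thesis
        unfolding sel zero[OF A0 c] by (rule inC[OF ratio_carrier[OF A0 c zero_carrier_mat]])
    qed
  next
    fix X assume X: "X \<in> carrier ?V"
    then obtain m n A where *: "A \<in> mats_of_ratio \<mu>" "A \<in> carrier_mat m n" "X = \<langle>A\<rangle>"
      by (rule Sigma_common1)
    have Z: "0\<^sub>m m n \<in> mats_of_ratio \<mu>" "- A \<in> mats_of_ratio \<mu>"
      using ratio_carrier[OF *(1,2)] *(2) by simp_all
    show "\<zero>\<^bsub>?V\<^esub> \<oplus>\<^bsub>?V\<^esub> X = X"
      using class_add_same_size[OF Z(1) zero_carrier_mat *(2)] zero[OF *(1,2)]
      by (simp add: sel *(3) left_add_zero_mat[OF *(2)])
    show "\<exists>Y\<in>carrier ?V. Y \<oplus>\<^bsub>?V\<^esub> X = \<zero>\<^bsub>?V\<^esub>"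
      using class_add_same_size[OF Z(2) _ *(2)] zero[OF *(1,2)] inC[OF Z(2)] *(2)
      by (intro bexI[of _ "\<langle>- A\<rangle>"]) (simp_all add: sel *(3) uminus_l_inv_mat[OF *(2)])
  qed
  have "module (class_ring :: real ring) ?V"
  proof (rule moduleI[OF class_cring.is_cring ag])
    fix a b :: real and X Y assume "X \<in> carrier ?V" "Y \<in> carrier ?V"
    then obtain m n A B where *: "A \<in> mats_of_ratio \<mu>" "A \<in> carrier_mat m n" "B \<in> carrier_mat m n"
      "X = \<langle>A\<rangle>" "Y = \<langle>B\<rangle>" by (rule Sigma_common2)
    have S: "a \<cdot>\<^sub>m A \<in> mats_of_ratio \<mu>" using ratio_carrier[OF *(1,2)] *(2) by simp
    show "a \<odot>\<^bsub>?V\<^esub> (X \<oplus>\<^bsub>?V\<^esub> Y) = a \<odot>\<^bsub>?V\<^esub> X \<oplus>\<^bsub>?V\<^esub> a \<odot>\<^bsub>?V\<^esub> Y"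
      using class_add_same_size[OF *(1,2,3)] class_add_same_size[OF S, of m n "a \<cdot>\<^sub>m B"] *(2,3)
      by (simp add: sel *(4,5) class_smult_id_class add_smult_distrib_left_mat[OF *(2,3)])
  next
    fix a b :: real and X assume "X \<in> carrier ?V"
    then obtain m n A where *: "A \<in> mats_of_ratio \<mu>" "A \<in> carrier_mat m n" "X = \<langle>A\<rangle>"
      by (rule Sigma_common1)
    have S: "a \<cdot>\<^sub>m A \<in> mats_of_ratio \<mu>" for a using ratio_carrier[OF *(1,2)] *(2) by simp
    show "a \<odot>\<^bsub>?V\<^esub> X \<in> carrier ?V"
      using inC[OF S] by (simp add: sel *(3) class_smult_id_class)
    show "(a \<oplus>\<^bsub>class_ring\<^esub> b) \<odot>\<^bsub>?V\<^esub> X = a \<odot>\<^bsub>?V\<^esub> X \<oplus>\<^bsub>?V\<^esub> b \<odot>\<^bsub>?V\<^esub> X"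
      using class_add_same_size[OF S, of a m n "b \<cdot>\<^sub>m A"] *(2)
      by (simp add: sel *(3) class_smult_id_class add_smult_distrib_right_mat[OF *(2)])
    show "(a \<otimes>\<^bsub>class_ring\<^esub> b) \<odot>\<^bsub>?V\<^esub> X = a \<odot>\<^bsub>?V\<^esub> (b \<odot>\<^bsub>?V\<^esub> X)"
    proof -
      have "(a * b) \<cdot>\<^sub>m A = a \<cdot>\<^sub>m (b \<cdot>\<^sub>m A)" by (rule eq_matI) auto
      then show ?thesis by (simp add: sel *(3) class_smult_id_class)
    qed
    have "1 \<cdot>\<^sub>m A = A" by (rule eq_matI) auto
    then show "\<one>\<^bsub>class_ring\<^esub> \<odot>\<^bsub>?V\<^esub> X = X"
      by (simp add: sel *(3) class_smult_id_class)
  qed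
  then show ?thesis
    by (rule vectorspace.intro[OF _ class_field])
qed

end

theory Submission
  imports Defs
begin

text \<open>
  Write \<open>L k\<close> for the set of classes that have a representative of size \<open>kp \<times> kq\<close>.
  On representatives of one common size, \<open>\<boxplus>\<close> is ordinary matrix addition, so every \<open>L k\<close> is
  a subspace (\<open>classes_of_size_submodule\<close>). Since \<open>p\<close> and \<open>q\<close> are coprime, every matrix of ratio
  \<open>p/q\<close> has size \<open>kp \<times> kq\<close> for some \<open>k \<ge> 1\<close>, so the space is the union of the \<open>L k\<close>
  (\<open>Sigma_carrier_eq_Union\<close>). The union is directed, because tensoring with an identity matrix
  puts \<open>L k\<close> inside \<open>L (kl)\<close>.

  The classes of the matrix units span, because a matrix is a linear combination of the matrix
  units of its own size (\<open>id_class_in_submodule_if_units\<close>). There are countably many of these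
  classes, so a basis can be chosen among them, keeping those that do not depend linearly on
  earlier ones (\<open>countable_basis_of_countable_gen_set\<close>).

  No finite set spans. It would lie in a single \<open>L k\<close>, and so would its span; but the class of
  the first matrix unit of size \<open>2kp \<times> 2kq\<close> is not in \<open>L k\<close>
  (\<open>unit_mat_class_not_of_half_size\<close>). Hence the countable basis is infinite.
\<close>

section \<open>Bases of countably generated vector spaces\<close>

text \<open>
  Enumerate the generating set as \<open>g 0, g 1, \<dots>\<close> and keep \<open>g n\<close> exactly if it is not in the span
  of its predecessors. The vectors kept among the first \<open>n\<close> are independent by induction
  on \<open>n\<close>, and a linear relation involves only finitely many vectors. Every \<open>g n\<close> lies in the
  span of the kept ones: it is kept itself or depends on predecessors that lie in that span.
\<close>

lemma (in vectorspace) countable_basis_of_countable_gen_set: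
  assumes G: "countable G" "G \<subseteq> carrier V" and gen: "span G = carrier V"
  obtains B where "basis B" "B \<subseteq> G"
proof (cases "G = {}")
  case True
  have "lin_indpt {}" unfolding lin_dep_def by auto
  then have "basis {}" using gen True unfolding basis_def by simp
  then show thesis by (rule that) simp
next
  case False
  define g where "g = from_nat_into G"
  have G_eq: "G = range g" unfolding g_def using False G(1) by simp
  have gV: "g n \<in> carrier V" for n using G(2) G_eq by blast
  define D where "D n = {g k | k. k < n \<and> g k \<notin> span (g ` {..<k})}" for n
  define B where "B = (\<Union>n. D n)"
  have DG: "D n \<subseteq> g ` {..<n}" for n unfolding D_def by auto
  have DV: "D n \<subseteq> carrier V" for n using DG gV by blast
  have BG: "B \<subseteq> G" using DG G_eq unfolding B_def by blast
  then have BV: "B \<subseteq> carrier V" using G(2) by blast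
  have D_li: "lin_indpt (D n)" for n
  proof (induction n)
    case 0
    show ?case unfolding D_def lin_dep_def by simp
  next
    case (Suc n)
    have step: "D (Suc n) = D n \<union> (if g n \<in> span (g ` {..<n}) then {} else {g n})"
      unfolding D_def less_Suc_eq by auto
    show ?case
    proof (cases "g n \<in> span (g ` {..<n})")
      case True
      then show ?thesis using Suc.IH step by simp
    next
      case new: False
      then have ns: "g n \<notin> span (D n)" using span_is_monotone[OF DG] by blast
      moreover have "g n \<notin> D n" using ns span_mem[OF DV] by blast
      ultimately have "lin_indpt (D n \<union> {g n})"
        using lin_dep_iff_in_span[OF DV Suc.IH gV] by blast
      then show ?thesis using step new by simp
    qed
  qed
  have B_li: "lin_indpt B"
  proof
    assume "lin_dep B"
    then obtain A a v where A: "finite A" "A \<subseteq> B" and rel: "a \<in> A \<rightarrow> carrier K"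
      "lincomb a A = \<zero>\<^bsub>V\<^esub>" "v \<in> A" "a v \<noteq> \<zero>\<^bsub>K\<^esub>"
      unfolding lin_dep_def by blast
    have "mono D" by (rule monoI) (auto simp: D_def)
    with A have "\<exists>n. A \<subseteq> D n"
    proof (induction rule: finite_induct)
      case (insert x A)
      then obtain n m where "A \<subseteq> D n" "x \<in> D m" unfolding B_def by auto
      then have "insert x A \<subseteq> D (max n m)"
        using monoD[OF \<open>mono D\<close>, of n "max n m"] monoD[OF \<open>mono D\<close>, of m "max n m"] by auto
      then show ?case by blast
    qed simp
    then obtain n where "A \<subseteq> D n" by blast
    then have "lin_dep (D n)" using A rel by (intro lin_dep_crit[of A _ a v]) auto
    then show False using D_li by blast
  qed
  have "g n \<in> span B" for n
  proof (induction n rule: less_induct)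
    case (less n)
    show ?case
    proof (cases "g n \<in> span (g ` {..<n})")
      case True
      have "span (g ` {..<n}) \<subseteq> span B"
        by (rule span_is_subset[OF _ span_is_submodule[OF BV]]) (use less in auto)
      then show ?thesis using True by blast
    next
      case False
      then have "g n \<in> D (Suc n)" unfolding D_def by blast
      then show ?thesis using span_mem[OF BV] unfolding B_def by blast
    qed
  qed
  then have "span G \<subseteq> span B"
    by (intro span_is_subset[OF _ span_is_submodule[OF BV]]) (auto simp: G_eq)
  then have "span B = carrier V" using gen span_is_subset2[OF BV] by blast
  then have "basis B" using B_li BV unfolding basis_def by simp
  then show thesis using BG by (rule that)
qed

section \<open>Classes with a representative of a given size\<close>

definition classes_of_size :: "nat \<Rightarrow> nat \<Rightarrow> real mat set set"
  where "classes_of_size m n = id_class ` carrier_mat m n"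

lemma carrier_mat_subset_ratio:
  assumes "0 < m" "0 < n" "\<mu> = of_nat m / of_nat n"
  shows "carrier_mat m n \<subseteq> mats_of_ratio \<mu>"
  using assms by (auto simp: mats_of_ratio_def)

lemma classes_of_size_mult:
  assumes "0 < s"
  shows "classes_of_size m n \<subseteq> classes_of_size (m * s) (n * s)"
proof
  fix X assume "X \<in> classes_of_size m n"
  then obtain A where "A \<in> carrier_mat m n" "X = \<langle>A\<rangle>" by (auto simp: classes_of_size_def)
  then have "X = \<langle>A \<otimes>\<^sub>m 1\<^sub>m s\<rangle>" "A \<otimes>\<^sub>m 1\<^sub>m s \<in> carrier_mat (m * s) (n * s)"
    using id_class_kron_one[OF assms] by auto
  then show "X \<in> classes_of_size (m * s) (n * s)" by (auto simp: classes_of_size_def)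
qed

lemma Sigma_sel:
  "add (Sigma_space \<mu>) = class_add" "zero (Sigma_space \<mu>) = class_zero \<mu>"
  "smult (Sigma_space \<mu>) = class_smult"
  by (simp_all add: Sigma_space_def)

lemma classes_of_size_submodule:
  assumes "0 < m" "0 < n" "\<mu> = of_nat m / of_nat n"
  shows "submodule (class_ring :: real ring) (classes_of_size m n) (Sigma_space \<mu>)"
proof -
  have "0 < \<mu>" using assms by simp
  then interpret vectorspace "class_ring :: real ring" "Sigma_space \<mu>" by (rule Sigma_vectorspace)
  note R = subsetD[OF carrier_mat_subset_ratio[OF assms]]
  show ?thesis
  proof
    show "classes_of_size m n \<subseteq> carrier (Sigma_space \<mu>)"
      using R by (auto simp: classes_of_size_def Sigma_carrier)
    show "\<zero>\<^bsub>Sigma_space \<mu>\<^esub> \<in> classes_of_size m n"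
      using class_zero_eq[OF R[OF zero_carrier_mat]] by (auto simp: classes_of_size_def Sigma_sel)
  next
    fix X Y assume "X \<in> classes_of_size m n" "Y \<in> classes_of_size m n"
    then obtain A B where "A \<in> carrier_mat m n" "B \<in> carrier_mat m n" "X = \<langle>A\<rangle>" "Y = \<langle>B\<rangle>"
      by (auto simp: classes_of_size_def)
    then show "X \<oplus>\<^bsub>Sigma_space \<mu>\<^esub> Y \<in> classes_of_size m n"
      using class_add_same_size[OF R] by (auto simp: classes_of_size_def Sigma_sel)
  next
    fix c :: real and X assume "X \<in> classes_of_size m n"
    then show "c \<odot>\<^bsub>Sigma_space \<mu>\<^esub> X \<in> classes_of_size m n"
      by (auto simp: classes_of_size_def Sigma_sel class_smult_id_class)
  qed
qed

section \<open>Exhaustion by a directed family of subspaces\<close>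

lemma mats_of_ratio_dims:
  assumes "0 < p" "0 < q" "coprime p q" "A \<in> mats_of_ratio (of_nat p / of_nat q)"
  obtains k where "0 < k" "A \<in> carrier_mat (k * p) (k * q)"
proof -
  have pos: "0 < dim_row A" "0 < dim_col A" using assms(4) by (auto simp: mats_of_ratio_def)
  have "0\<^sub>m p q \<in> mats_of_ratio (of_nat p / of_nat q)" using assms by (auto simp: mats_of_ratio_def)
  from ratio_cols[OF assms(4) this] have eq: "dim_row A * q = p * dim_col A" by simp
  then have "p dvd dim_row A * q" by simp
  then have "p dvd dim_row A" using assms(3) by (simp add: coprime_dvd_mult_left_iff)
  then obtain k where k: "dim_row A = k * p" by (auto simp: dvd_def mult.commute)
  have "dim_col A = k * q" using eq k assms(1) by simp
  with k pos that[of k] show thesis by (cases k) auto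
qed

lemma Sigma_carrier_eq_Union:
  assumes "0 < p" "0 < q" "coprime p q"
  shows "carrier (Sigma_space (of_nat p / of_nat q)) = (\<Union>k\<in>{1..}. classes_of_size (k * p) (k * q))"
proof (intro equalityI subsetI)
  fix X assume "X \<in> carrier (Sigma_space (of_nat p / of_nat q))"
  then obtain A where A: "A \<in> mats_of_ratio (of_nat p / of_nat q)" "X = \<langle>A\<rangle>"
    by (auto simp: Sigma_carrier)
  obtain k where "0 < k" "A \<in> carrier_mat (k * p) (k * q)"
    by (rule mats_of_ratio_dims[OF assms A(1)])
  with A show "X \<in> (\<Union>k\<in>{1..}. classes_of_size (k * p) (k * q))"
    by (auto simp: classes_of_size_def intro!: bexI[of _ k])
next
  fix X assume "X \<in> (\<Union>k\<in>{1..}. classes_of_size (k * p) (k * q))"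
  then obtain k A where "0 < k" "A \<in> carrier_mat (k * p) (k * q)" "X = \<langle>A\<rangle>"
    by (auto simp: classes_of_size_def Suc_le_eq)
  then show "X \<in> carrier (Sigma_space (of_nat p / of_nat q))"
    using carrier_mat_subset_ratio[of "k * p" "k * q" "of_nat p / of_nat q"] assms
    by (auto simp: Sigma_carrier)
qed

text \<open>
  The family is directed under divisibility of \<open>k\<close>: the levels \<open>k\<close> and \<open>l\<close> both lie in the
  level \<open>k * l\<close>.
\<close>

lemma finite_subset_classes_of_size:
  assumes "finite B" "B \<subseteq> (\<Union>k\<in>{1..}. classes_of_size (k * p) (k * q))"
  obtains k where "0 < k" "B \<subseteq> classes_of_size (k * p) (k * q)"
proof -
  have "\<exists>k>0. B \<subseteq> classes_of_size (k * p) (k * q)"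
    using assms
  proof (induction rule: finite_induct)
    case (insert X B)
    then obtain k l where kl: "0 < k" "0 < l" "B \<subseteq> classes_of_size (k * p) (k * q)"
      "X \<in> classes_of_size (l * p) (l * q)"
      by (auto simp: Suc_le_eq)
    have "insert X B \<subseteq> classes_of_size (k * l * p) (k * l * q)"
      using kl classes_of_size_mult[OF kl(2), of "k * p" "k * q"]
        classes_of_size_mult[OF kl(1), of "l * p" "l * q"]
      by (auto simp: ac_simps)
    with kl show ?case by (intro exI[of _ "k * l"]) simp
  qed auto
  then show thesis using that by blast
qed

text \<open>
  If \<open>E \<otimes> I\<^sub>s = A \<otimes> I\<^sub>t\<close> with \<open>E\<close> twice as large as \<open>A\<close> in both directions, then \<open>t = 2s\<close>. The
  diagonal positions \<open>0\<close> and \<open>s\<close> lie in the same \<open>t \<times> t\<close> block of the right-hand side, whose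
  diagonal is constant, but in different \<open>s \<times> s\<close> blocks of the left-hand side, which carry the
  first two diagonal entries of \<open>E\<close>. These are \<open>1\<close> and \<open>0\<close> for the first matrix unit.
\<close>

lemma unit_mat_class_not_of_half_size:
  assumes "0 < m" "0 < n"
  shows "\<langle>unit_mat (2 * m) (2 * n) 1 1\<rangle> \<notin> classes_of_size m n"
proof
  let ?E = "unit_mat (2 * m) (2 * n) 1 1"
  assume "\<langle>?E\<rangle> \<in> classes_of_size m n"
  then obtain A where A: "A \<in> carrier_mat m n" "\<langle>?E\<rangle> = \<langle>A\<rangle>" by (auto simp: classes_of_size_def)
  then obtain s t where st: "0 < s" "0 < t" and eq: "?E \<otimes>\<^sub>m 1\<^sub>m s = A \<otimes>\<^sub>m 1\<^sub>m t"
    by (auto simp: id_class_eq_iff id_equiv_def)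
  have dimE: "dim_row ?E = 2 * m" "dim_col ?E = 2 * n" by (simp_all add: unit_mat_def)
  have "2 * m * s = m * t" using arg_cong[OF eq, of dim_row] A(1) dimE by simp
  then have t: "t = 2 * s" using assms by simp
  have s_bounds: "s < 2 * m * s" "s < 2 * n * s" using assms st by auto
  have A_const: "(A \<otimes>\<^sub>m 1\<^sub>m t) $$ (i, i) = A $$ (0, 0)" if "i \<in> {0, s}" for i
    using that A(1) assms st s_bounds by (subst kron_one_index) (auto simp: t)
  have "(?E \<otimes>\<^sub>m 1\<^sub>m s) $$ (0, 0) = 1"
    using assms st s_bounds dimE by (subst kron_one_index) (auto simp: unit_mat_def)
  moreover have "(?E \<otimes>\<^sub>m 1\<^sub>m s) $$ (s, s) = 0"
    using assms st s_bounds dimE by (subst kron_one_index) (auto simp: unit_mat_def)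
  ultimately show False using A_const[of 0] A_const[of s] eq by simp
qed

section \<open>Classes of matrix units as generators\<close>

text \<open>
  The expansion of \<open>A\<close> in matrix units is built up one entry at a time, by induction on
  the set of positions already filled in.
\<close>

lemma id_class_in_submodule_if_units:
  assumes N: "submodule (class_ring :: real ring) N (Sigma_space \<mu>)"
    and A: "A \<in> carrier_mat m n" "A \<in> mats_of_ratio \<mu>"
    and units: "\<And>i j. i \<in> {1..m} \<Longrightarrow> j \<in> {1..n} \<Longrightarrow> \<langle>unit_mat m n i j\<rangle> \<in> N"
  shows "\<langle>A\<rangle> \<in> N"
proof -
  interpret submodule "class_ring :: real ring" N "Sigma_space \<mu>" by (rule N)
  define cut where "cut S = mat m n (\<lambda>ij. if ij \<in> S then A $$ ij else 0)" for S
  have cutC: "cut S \<in> carrier_mat m n" for S by (simp add: cut_def)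
  have R: "B \<in> mats_of_ratio \<mu>" if "B \<in> carrier_mat m n" for B
    using ratio_carrier[OF A(2,1) that] .
  have "\<langle>cut S\<rangle> \<in> N" if "finite S" "S \<subseteq> {..<m} \<times> {..<n}" for S
    using that
  proof (induction rule: finite_induct)
    case empty
    have "cut {} = 0\<^sub>m m n" by (auto simp: cut_def)
    then show ?case using zero_closed class_zero_eq[OF R[OF zero_carrier_mat]] by (simp add: Sigma_sel)
  next
    case (insert x S)
    obtain i j where x: "x = (i, j)" "i < m" "j < n" using insert.prems by auto
    let ?E = "unit_mat m n (Suc i) (Suc j)"
    have E: "A $$ x \<cdot>\<^sub>m ?E \<in> carrier_mat m n" by (simp add: unit_mat_def)
    have "cut (insert x S) = cut S + A $$ x \<cdot>\<^sub>m ?E"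
      using insert.hyps x by (intro eq_matI) (auto simp: cut_def unit_mat_def)
    then have "\<langle>cut (insert x S)\<rangle> = \<langle>cut S\<rangle> \<oplus>\<^bsub>Sigma_space \<mu>\<^esub> (A $$ x) \<odot>\<^bsub>Sigma_space \<mu>\<^esub> \<langle>?E\<rangle>"
      using class_add_same_size[OF R[OF cutC] cutC E] by (simp add: Sigma_sel class_smult_id_class)
    moreover have "\<langle>?E\<rangle> \<in> N" by (rule units) (use x in auto)
    ultimately show ?case using insert by (auto intro!: m_closed smult_closed)
  qed
  from this[of "{..<m} \<times> {..<n}"] have "\<langle>cut ({..<m} \<times> {..<n})\<rangle> \<in> N" by simp
  moreover have "cut ({..<m} \<times> {..<n}) = A" using A(1) by (intro eq_matI) (auto simp: cut_def)
  ultimately show ?thesis by simp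
qed

section \<open>Dimension and generators\<close>

theorem proposition14:
  fixes \<mu> :: rat and p q :: nat
  assumes "0 < p" and "0 < q" and "coprime p q"
    and "\<mu> = of_nat p / of_nat q"
  shows "(\<exists>B. vectorspace.basis (class_ring :: real ring) (Sigma_space \<mu>) B
            \<and> countable B \<and> infinite B)
       \<and> LinearCombinations.module.span (class_ring :: real ring) (Sigma_space \<mu>)
           (\<Union>k\<in>{1..}. \<Union>i\<in>{1..k * p}. \<Union>j\<in>{1..k * q}. {\<langle>unit_mat (k * p) (k * q) i j\<rangle>})
         = carrier (Sigma_space \<mu>)"
proof -
  let ?V = "Sigma_space \<mu>"
  let ?G = "\<Union>k\<in>{1..}. \<Union>i\<in>{1..k * p}. \<Union>j\<in>{1..k * q}. {\<langle>unit_mat (k * p) (k * q) i j\<rangle>}"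
  have "0 < \<mu>" using assms by simp
  then interpret vectorspace "class_ring :: real ring" ?V by (rule Sigma_vectorspace)
  have carrier_eq: "carrier ?V = (\<Union>k\<in>{1..}. classes_of_size (k * p) (k * q))"
    using Sigma_carrier_eq_Union[OF assms(1-3)] assms(4) by simp
  have unit_in: "\<langle>unit_mat (k * p) (k * q) i j\<rangle> \<in> classes_of_size (k * p) (k * q)" for k i j
    by (auto simp: classes_of_size_def unit_mat_def)
  have GV: "?G \<subseteq> carrier ?V" unfolding carrier_eq using unit_in by blast
  have "carrier ?V \<subseteq> span ?G"
  proof
    fix X assume "X \<in> carrier ?V"
    then obtain k A where k: "1 \<le> k" "A \<in> carrier_mat (k * p) (k * q)" "X = \<langle>A\<rangle>"
      unfolding carrier_eq by (auto simp: classes_of_size_def)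
    have "A \<in> mats_of_ratio \<mu>"
      using carrier_mat_subset_ratio[of "k * p" "k * q" \<mu>] k assms by auto
    then have "\<langle>A\<rangle> \<in> span ?G"
      by (rule id_class_in_submodule_if_units[OF span_is_submodule[OF GV] k(2)])
        (rule subsetD[OF in_own_span[OF GV]], use k(1) in blast)
    then show "X \<in> span ?G" using k by simp
  qed
  then have span_G: "span ?G = carrier ?V" using span_is_subset2[OF GV] by blast
  have "countable ?G" by (intro countable_UN) auto
  then obtain B where B: "basis B" "B \<subseteq> ?G"
    using countable_basis_of_countable_gen_set[OF _ GV span_G] by blast
  have "infinite B"
  proof
    assume "finite B"
    moreover have "B \<subseteq> carrier ?V" using B(2) GV by blast
    ultimately obtain k where k: "0 < k" "B \<subseteq> classes_of_size (k * p) (k * q)"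
      unfolding carrier_eq using finite_subset_classes_of_size by blast
    have "submodule class_ring (classes_of_size (k * p) (k * q)) ?V"
      by (rule classes_of_size_submodule) (use k assms in auto)
    then have "carrier ?V \<subseteq> classes_of_size (k * p) (k * q)"
      using span_is_subset[OF k(2)] B(1) by (simp add: basis_def)
    moreover have "\<langle>unit_mat (2 * k * p) (2 * k * q) 1 1\<rangle> \<in> carrier ?V"
      unfolding carrier_eq using k(1) unit_in[of "2 * k"] by (intro UN_I[of "2 * k"]) auto
    ultimately show False
      using unit_mat_class_not_of_half_size[of "k * p" "k * q"] k assms by (auto simp: mult.assoc)
  qed
  moreover have "countable B" using B(2) \<open>countable ?G\<close> by (rule countable_subset)
  ultimately show ?thesis using B(1) span_G by blast
qed

end
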